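(* For $t>0$, let $W_t(x)=(4\pi t)^{-n/2}e^{-|x|^2/4t}$ be the Weierstrass kernel in $\mathbb{R}^n$. For $t>0$ and $x,y\in\mathbb{R}^n$ let $$d_t(x,y)=\left(\int_{\mathbb{R}^n}\left|W_t(x-z)-W_t(y-z)\right|^2\,dz\right)^{1/2}.$$ Then: (a) $d_t$ is translation invariant; (b) $d_t(x,y)$ depends only on $|x-y|$, i.e. $d_t(x,y)=\rho_t(|x-y|)$ for a function $\rho_t$ on $[0,\infty)$; (c) $\rho_t$ is strictly increasing and continuous, with $\rho_t(0)=0$; (d) $\displaystyle\lim_{r\to0^+}\frac{\rho_{t_1}(r)}{\rho_{t_2}(r)}=\left(\frac{t_2}{t_1}\right)^{\frac n4+\frac12}$ for $t_1,t_2>0$; (e) the family of $d_t$-balls are the Euclidean balls.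
   Context: $|\cdot|$ denotes the Euclidean norm on $\mathbb{R}^n$. Translation invariance of $d_t$ means $d_t(x+w,y+w)=d_t(x,y)$ for all $x,y,w\in\mathbb{R}^n$. The $d_t$-balls are the sets $\{y\in\mathbb{R}^n\colon d_t(x,y)<r\}$ with $x\in\mathbb{R}^n$ and $r>0$; the Euclidean balls are the sets $\{y\in\mathbb{R}^n\colon |x-y|<r\}$ with $x\in\mathbb{R}^n$ and $r>0$.
   Formalization: Part (e) is corrected: since d_t is bounded, d_t-balls of radius at least √2(8πt)^(-n/4) are all of ℝⁿ, so the family of d_t-balls is shown to be the Euclidean balls together with the whole space ℝⁿ. *)

theory Defs
  imports "HOL-Analysis.Analysis"
begin

definition weierstrass :: "real \<Rightarrow> real ^ 'n::finite \<Rightarrow> real" where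
  "weierstrass t x = (4 * pi * t) powr (- (real CARD('n) / 2)) * exp (- (norm x)\<^sup>2 / (4 * t))"

definition wdist :: "real \<Rightarrow> real ^ 'n::finite \<Rightarrow> real ^ 'n \<Rightarrow> real" where
  "wdist t x y = sqrt (LINT z|lborel. \<bar>weierstrass t (x - z) - weierstrass t (y - z)\<bar>\<^sup>2)"

(* wdist t is bounded, so a ball of sufficiently large radius is the whole space. *)
definition wball :: "real \<Rightarrow> real ^ 'n::finite \<Rightarrow> real \<Rightarrow> (real ^ 'n) set" where
  "wball t x r = {y. wdist t x y < r}"

end

theory Submission
  imports Defs "HOL-Probability.Distributions" "HOL-Real_Asymp.Real_Asymp"
begin

text \<open>
  Everything follows from a closed formula for the distance. Expanding the square in the
  definition of \<open>d\<^sub>t(x, y)\<close> leaves three integrals of the form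
  \<open>\<integral> W\<^sub>t(u - z) W\<^sub>t(v - z) dz\<close> with \<open>u\<close> and \<open>v\<close> among \<open>x\<close> and \<open>y\<close>. By the semigroup property of
  the heat kernel (lemma \<open>weierstrass_convolution\<close>) each of them is the kernel at time \<open>2t\<close>,
  evaluated at \<open>u - v\<close>, so that
  \<open>d\<^sub>t(x, y)\<^sup>2 = 2 (8 \<pi> t)^(-n/2) (1 - exp (- |x - y|\<^sup>2 / 8t))\<close>.
  The right-hand side depends on \<open>|x - y|\<close> alone and increases strictly with it from \<open>0\<close>. Near \<open>0\<close>
  it is asymptotic to \<open>2 (8 \<pi> t)^(-n/2) |x - y|\<^sup>2 / 8t\<close>, so the quotient of its values for \<open>t\<^sub>1\<close>
  and \<open>t\<^sub>2\<close> tends to \<open>(t\<^sub>2/t\<^sub>1)^(n/2 + 1)\<close>, and the quotient of the distances to the square root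
  of this.

  The right-hand side is also bounded, with supremum \<open>2 (8 \<pi> t)^(-n/2)\<close>, which is not
  attained. A ball whose radius is at least the square root of this supremum is therefore the whole
  space. Every smaller positive radius is, by the intermediate value theorem, the value of the
  distance at exactly one Euclidean distance \<open>s > 0\<close>, and by monotonicity the ball is the Euclidean
  one of radius \<open>s\<close>; conversely every \<open>s > 0\<close> arises in this way.
\<close>

section \<open>The Weierstrass kernel\<close>

text \<open>
  As a function of \<open>z\<close> the kernel is the product over the coordinates of normal densities of
  variance \<open>2t\<close>, so that Tonelli's theorem gives integrability and the value of the integral from
  the one-dimensional case.
\<close>

lemma has_bochner_integral_weierstrass:
  fixes m :: "real ^ 'n::finite"
  assumes t: "t > 0"
  shows "has_bochner_integral lborel (\<lambda>z. weierstrass t (m - z)) 1"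
proof (rule has_bochner_integral_nn_integral)
  have const: "1 / sqrt (2 * pi * (sqrt (2 * t))\<^sup>2) = (4 * pi * t) powr (- 1 / 2)"
    using t by (simp add: powr_minus_divide powr_half_sqrt)
  have factor: "normal_density (m \<bullet> b) (sqrt (2 * t)) (z \<bullet> b)
      = (4 * pi * t) powr (- 1 / 2) * exp (- ((m - z) \<bullet> b)\<^sup>2 / (4 * t))" for z b :: "real ^ 'n"
    using t unfolding normal_density_def const
    by (simp add: inner_diff_left power2_commute)
  have eq: "weierstrass t (m - z)
      = (\<Prod>b\<in>Basis. normal_density (m \<bullet> b) (sqrt (2 * t)) (z \<bullet> b))" for z
  proof -
    have "(\<Prod>b\<in>Basis. normal_density (m \<bullet> b) (sqrt (2 * t)) (z \<bullet> b))
        = ((4 * pi * t) powr (- 1 / 2)) ^ CARD('n)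
          * exp (\<Sum>b\<in>(Basis :: (real ^ 'n) set). - ((m - z) \<bullet> b)\<^sup>2 / (4 * t))"
      unfolding factor by (simp add: prod.distrib exp_sum)
    also have "((4 * pi * t) powr (- 1 / 2)) ^ CARD('n) = (4 * pi * t) powr (- (real CARD('n) / 2))"
      using t by (simp add: powr_power)
    also have "(\<Sum>b\<in>(Basis :: (real ^ 'n) set). - ((m - z) \<bullet> b)\<^sup>2 / (4 * t))
        = - (norm (m - z))\<^sup>2 / (4 * t)"
      unfolding power2_norm_eq_inner euclidean_inner[of "m - z" "m - z"]
      by (simp only: power2_eq_square sum_negf flip: sum_divide_distrib)
    finally show ?thesis by (simp add: weierstrass_def)
  qed
  show "(\<lambda>z. weierstrass t (m - z)) \<in> borel_measurable lborel"
    unfolding weierstrass_def by measurable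
  show "AE z in lborel. 0 \<le> weierstrass t (m - z)"
    by (simp add: weierstrass_def)
  have one: "(\<integral>\<^sup>+u. ennreal (normal_density \<mu> (sqrt (2 * t)) u) \<partial>lborel) = 1" for \<mu>
    using t by (subst nn_integral_eq_integral) auto
  have "(\<integral>\<^sup>+z. ennreal (weierstrass t (m - z)) \<partial>lborel)
      = (\<integral>\<^sup>+z. (\<Prod>b\<in>Basis. ennreal (normal_density (m \<bullet> b) (sqrt (2 * t)) (z \<bullet> b))) \<partial>lborel)"
    unfolding eq by (simp add: prod_ennreal)
  also have "\<dots> = 1"
    by (subst nn_integral_lborel_prod) (auto simp: one)
  finally show "(\<integral>\<^sup>+z. ennreal (weierstrass t (m - z)) \<partial>lborel) = ennreal 1"
    by simp
qed simp

text \<open>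
  The parallelogram law \<open>|x - z|\<^sup>2 + |y - z|\<^sup>2 = 2 |m - z|\<^sup>2 + |x - y|\<^sup>2 / 2\<close>, with \<open>m\<close> the midpoint
  of \<open>x\<close> and \<open>y\<close>, separates the integration variable \<open>z\<close> from the difference \<open>x - y\<close>.
\<close>

lemma weierstrass_mult:
  fixes x y z :: "real ^ 'n::finite"
  assumes t: "t > 0"
  shows "weierstrass t (x - z) * weierstrass t (y - z)
    = weierstrass (2 * t) (x - y) * weierstrass (t / 2) (midpoint x y - z)"
proof -
  have "midpoint x y - z = (1 / 2) *\<^sub>R ((x - z) + (y - z))"
    by (simp add: midpoint_def vec_eq_iff field_simps)
  then have "(norm (midpoint x y - z))\<^sup>2 = (norm ((x - z) + (y - z)))\<^sup>2 / 4"
    by (simp add: power_divide)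
  moreover have "(norm (a + b))\<^sup>2 + (norm (a - b))\<^sup>2 = 2 * (norm a)\<^sup>2 + 2 * (norm b)\<^sup>2"
    for a b :: "real ^ 'n"
    by (simp add: power2_norm_eq_inner inner_diff_left inner_diff_right
          inner_add_left inner_add_right inner_commute)
  from this[of "x - z" "y - z"] have "(norm ((x - z) + (y - z)))\<^sup>2 + (norm (x - y))\<^sup>2
      = 2 * (norm (x - z))\<^sup>2 + 2 * (norm (y - z))\<^sup>2"
    by simp
  ultimately have squares: "(norm (x - z))\<^sup>2 + (norm (y - z))\<^sup>2
      = 2 * (norm (midpoint x y - z))\<^sup>2 + (norm (x - y))\<^sup>2 / 2"
    by linarith
  have "- (norm (x - z))\<^sup>2 / (4 * t) + - (norm (y - z))\<^sup>2 / (4 * t)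
      = - ((norm (x - z))\<^sup>2 + (norm (y - z))\<^sup>2) / (4 * t)"
    by (simp add: diff_divide_distrib)
  then have exponent: "- (norm (x - z))\<^sup>2 / (4 * t) + - (norm (y - z))\<^sup>2 / (4 * t)
      = - (norm (x - y))\<^sup>2 / (4 * (2 * t)) + - (norm (midpoint x y - z))\<^sup>2 / (4 * (t / 2))"
    using t unfolding squares by (simp add: field_simps)
  have const: "(4 * pi * t) powr a * (4 * pi * t) powr a
      = (4 * pi * (2 * t)) powr a * (4 * pi * (t / 2)) powr a" for a
    using t by (simp flip: powr_mult)
  have "weierstrass t (x - z) * weierstrass t (y - z)
      = ((4 * pi * t) powr (- (real CARD('n) / 2)) * (4 * pi * t) powr (- (real CARD('n) / 2)))
        * exp (- (norm (x - z))\<^sup>2 / (4 * t) + - (norm (y - z))\<^sup>2 / (4 * t))"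
    by (simp only: weierstrass_def exp_add mult_ac)
  also have "\<dots> = weierstrass (2 * t) (x - y) * weierstrass (t / 2) (midpoint x y - z)"
    unfolding const exponent by (simp only: weierstrass_def exp_add mult_ac)
  finally show ?thesis .
qed

text \<open>
  After \<open>weierstrass_mult\<close> the factor that still depends on \<open>z\<close> is a translate of the kernel at
  time \<open>t/2\<close>, which has integral \<open>1\<close>.
\<close>

lemma weierstrass_convolution:
  fixes x y :: "real ^ 'n::finite"
  assumes "t > 0"
  shows "has_bochner_integral lborel (\<lambda>z. weierstrass t (x - z) * weierstrass t (y - z))
    (weierstrass (2 * t) (x - y))"
proof -
  have "has_bochner_integral lborel
      (\<lambda>z. weierstrass (2 * t) (x - y) * weierstrass (t / 2) (midpoint x y - z))
      (weierstrass (2 * t) (x - y) * 1)"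
    using assms
    by (intro has_bochner_integral_mult_right has_bochner_integral_weierstrass) auto
  then show ?thesis
    using assms by (simp add: weierstrass_mult)
qed

section \<open>The profile of the distance\<close>

text \<open>
  The distance \<open>d\<^sub>t\<close> as a function \<open>\<rho>\<^sub>t\<close> of the Euclidean distance \<open>r\<close>. The dimension \<open>n\<close> enters
  through an exponent only and is therefore a real argument.
\<close>

definition dist_profile :: "real \<Rightarrow> real \<Rightarrow> real \<Rightarrow> real" where
  "dist_profile n t r = sqrt (2 * (8 * pi * t) powr (- (n / 2)) * (1 - exp (- r\<^sup>2 / (8 * t))))"

text \<open>
  The three terms of the expanded square are instances of \<open>weierstrass_convolution\<close>; the two
  square terms give the kernel at \<open>0\<close>.
\<close>

lemma wdist_eq_dist_profile:
  fixes x y :: "real ^ 'n::finite"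
  assumes t: "t > 0"
  shows "wdist t x y = dist_profile (real CARD('n)) t (norm (x - y))"
proof -
  let ?W = "weierstrass t :: real ^ 'n \<Rightarrow> real"
  have "has_bochner_integral lborel
      (\<lambda>z. ?W (x - z) * ?W (x - z) + ?W (y - z) * ?W (y - z) - 2 * (?W (x - z) * ?W (y - z)))
      (weierstrass (2 * t) (x - x) + weierstrass (2 * t) (y - y) - 2 * weierstrass (2 * t) (x - y))"
    by (intro has_bochner_integral_diff has_bochner_integral_add has_bochner_integral_mult_right
          weierstrass_convolution t)
  then have "(LINT z|lborel. \<bar>?W (x - z) - ?W (y - z)\<bar>\<^sup>2)
      = 2 * weierstrass (2 * t) (0 :: real ^ 'n) - 2 * weierstrass (2 * t) (x - y)"
    by (intro has_bochner_integral_integral_eq) (simp add: power2_eq_square algebra_simps)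
  then show ?thesis
    by (simp add: wdist_def dist_profile_def weierstrass_def algebra_simps)
qed

lemma dist_profile_zero [simp]: "dist_profile n t 0 = 0"
  by (simp add: dist_profile_def)

lemma strict_mono_on_dist_profile:
  assumes "t > 0"
  shows "strict_mono_on {0..} (dist_profile n t)"
proof (rule strict_mono_onI)
  fix r s :: real
  assume "r \<in> {0..}" "s \<in> {0..}" "r < s"
  then have "r\<^sup>2 < s\<^sup>2"
    by (intro power_strict_mono) auto
  then show "dist_profile n t r < dist_profile n t s"
    using assms by (simp add: dist_profile_def divide_strict_right_mono)
qed

lemma continuous_on_dist_profile: "continuous_on A (dist_profile n t)"
  unfolding dist_profile_def divide_inverse by (intro continuous_intros)

lemma dist_profile_bound:
  assumes "t > 0"
  shows "dist_profile n t r < sqrt (2 * (8 * pi * t) powr (- (n / 2)))"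
  using assms by (simp add: dist_profile_def)

lemma tendsto_dist_profile_at_top:
  assumes "t > 0"
  shows "(dist_profile n t \<longlongrightarrow> sqrt (2 * (8 * pi * t) powr (- (n / 2)))) at_top"
proof -
  have "((\<lambda>r. exp (- r\<^sup>2 / (8 * t))) \<longlongrightarrow> 0) at_top"
    using assms by real_asymp
  then have "((\<lambda>r. sqrt (2 * (8 * pi * t) powr (- (n / 2)) * (1 - exp (- r\<^sup>2 / (8 * t)))))
      \<longlongrightarrow> sqrt (2 * (8 * pi * t) powr (- (n / 2)) * (1 - 0))) at_top"
    by (intro tendsto_intros)
  then show ?thesis
    by (simp add: dist_profile_def[abs_def])
qed

lemma dist_profile_attains:
  assumes t: "t > 0" and r: "0 < r" "r < sqrt (2 * (8 * pi * t) powr (- (n / 2)))"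
  obtains s where "s > 0" "dist_profile n t s = r"
proof -
  have "eventually (\<lambda>s. r < dist_profile n t s \<and> 0 < s) at_top"
    by (intro eventually_conj order_tendstoD[OF tendsto_dist_profile_at_top[OF t]] r
          eventually_gt_at_top)
  then obtain u where u: "r < dist_profile n t u" "0 < u"
    using eventually_happens[of _ "at_top :: real filter"] by auto
  obtain s where "0 \<le> s" "dist_profile n t s = r"
    using IVT'[of "dist_profile n t" 0 r u] u r continuous_on_dist_profile by auto
  moreover from this r have "s \<noteq> 0"
    by auto
  ultimately show thesis
    by (intro that[of s]) auto
qed

text \<open>
  In the quotient of the squares the two Gaussian factors contribute \<open>t\<^sub>2/t\<^sub>1\<close>, because
  \<open>1 - exp (- r\<^sup>2 / 8t)\<close> is asymptotic to \<open>r\<^sup>2 / 8t\<close>, and the normalising constants contribute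
  \<open>(t\<^sub>2/t\<^sub>1)^(n/2)\<close>.
\<close>

lemma tendsto_dist_profile_ratio:
  assumes t: "t1 > 0" "t2 > 0"
  shows "((\<lambda>r. dist_profile n t1 r / dist_profile n t2 r) \<longlongrightarrow> (t2 / t1) powr (n / 4 + 1 / 2))
    (at_right 0)"
proof -
  have "((\<lambda>r. (1 - exp (- r\<^sup>2 / (8 * t1))) / (1 - exp (- r\<^sup>2 / (8 * t2)))) \<longlongrightarrow> inverse t1 / inverse t2)
      (at_right 0)"
    using t by real_asymp
  also have "inverse t1 / inverse t2 = t2 / t1"
    by (simp add: field_simps)
  finally have "((\<lambda>r. (1 - exp (- r\<^sup>2 / (8 * t1))) / (1 - exp (- r\<^sup>2 / (8 * t2)))) \<longlongrightarrow> t2 / t1)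
      (at_right 0)" .
  then have "((\<lambda>r. sqrt ((t2 / t1) powr (n / 2)
        * ((1 - exp (- r\<^sup>2 / (8 * t1))) / (1 - exp (- r\<^sup>2 / (8 * t2))))))
      \<longlongrightarrow> sqrt ((t2 / t1) powr (n / 2) * (t2 / t1))) (at_right 0)"
    by (intro tendsto_real_sqrt tendsto_mult tendsto_const)
  moreover have "sqrt ((t2 / t1) powr (n / 2) * (t2 / t1)) = (t2 / t1) powr (n / 4 + 1 / 2)"
  proof -
    have "(t2 / t1) powr (n / 2) * (t2 / t1) = (t2 / t1) powr (n / 2 + 1)"
      using t by (simp add: powr_add)
    then show ?thesis
      using t by (simp add: powr_half_sqrt[symmetric] powr_powr add_divide_distrib)
  qed
  moreover have "dist_profile n t1 r / dist_profile n t2 r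
      = sqrt ((t2 / t1) powr (n / 2)
          * ((1 - exp (- r\<^sup>2 / (8 * t1))) / (1 - exp (- r\<^sup>2 / (8 * t2)))))" for r
  proof -
    have "(8 * pi * t1) powr (- (n / 2)) / (8 * pi * t2) powr (- (n / 2)) = (t2 / t1) powr (n / 2)"
      using t by (simp add: powr_minus powr_mult powr_divide field_simps)
    then show ?thesis
      unfolding dist_profile_def real_sqrt_divide[symmetric] by (simp flip: times_divide_times_eq)
  qed
  ultimately show ?thesis
    by simp
qed

section \<open>Balls\<close>

lemma wball_eq_ball:
  fixes x :: "real ^ 'n::finite"
  assumes "t > 0" "s \<ge> 0"
  shows "wball t x (dist_profile (real CARD('n)) t s) = ball x s"
  using assms
  by (auto simp: wball_def wdist_eq_dist_profile dist_norm strict_mono_on_less[OF strict_mono_on_dist_profile])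

lemma wball_eq_UNIV:
  fixes x :: "real ^ 'n::finite"
  assumes "t > 0" "sqrt (2 * (8 * pi * t) powr (- (real CARD('n) / 2))) \<le> r"
  shows "wball t x r = UNIV"
  using assms less_le_trans[OF dist_profile_bound]
  by (auto simp: wball_def wdist_eq_dist_profile)

lemma wballs_eq:
  assumes t: "t > 0"
  shows "{wball t x r | (x :: real ^ 'n::finite) r. r > 0}
    = insert UNIV {ball x r | (x :: real ^ 'n) r. r > 0}"
proof (intro equalityI subsetI)
  let ?M = "sqrt (2 * (8 * pi * t) powr (- (real CARD('n) / 2)))"
  fix B :: "(real ^ 'n) set"
  {
    assume "B \<in> {wball t x r | x r. r > 0}"
    then obtain x r where B: "B = wball t x r" and r: "r > 0"
      by auto
    show "B \<in> insert UNIV {ball x r | x r. r > 0}"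
    proof (cases "r < ?M")
      case True
      with t r obtain s where s: "s > 0" "dist_profile (real CARD('n)) t s = r"
        using dist_profile_attains by blast
      then have "B = ball x s"
        using B wball_eq_ball[OF t, of s x] by simp
      then show ?thesis
        using s by auto
    next
      case False
      then have "B = UNIV"
        using B wball_eq_UNIV[OF t, of r x] by simp
      then show ?thesis
        by simp
    qed
  }
  {
    \<comment> \<open>The whole space is the ball whose radius is the supremum \<open>?M\<close> itself, since the
      distance stays below \<open>?M\<close>.\<close>
    assume "B \<in> insert UNIV {ball x r | x r. r > 0}"
    then consider "B = UNIV" | x s where "B = ball x s" "s > 0"
      by auto
    then show "B \<in> {wball t x r | x r. r > 0}"
    proof cases
      case 1
      moreover have "0 < ?M"
        using t by simp
      ultimately show ?thesis
        using wball_eq_UNIV[OF t order_refl] by blast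
    next
      case 2
      moreover have "0 < dist_profile (real CARD('n)) t s"
        using strict_mono_onD[OF strict_mono_on_dist_profile[OF t], of 0 s] 2 by simp
      ultimately show ?thesis
        using wball_eq_ball[OF t, of s x] by fastforce
    qed
  }
qed

section \<open>The proposition\<close>

theorem proposition1p1:
  shows "(\<forall>t>0. \<forall>x y w :: real ^ 'n::finite. wdist t (x + w) (y + w) = wdist t x y) \<and>
    (\<exists>\<rho> :: real \<Rightarrow> real \<Rightarrow> real.
      (\<forall>t>0. \<forall>x y :: real ^ 'n. wdist t x y = \<rho> t (norm (x - y))) \<and>
      (\<forall>t>0. strict_mono_on {0..} (\<rho> t) \<and> continuous_on {0..} (\<rho> t) \<and> \<rho> t 0 = 0) \<and>
      (\<forall>t1>0. \<forall>t2>0. ((\<lambda>r. \<rho> t1 r / \<rho> t2 r) \<longlongrightarrow>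
         (t2 / t1) powr (real CARD('n) / 4 + 1 / 2)) (at_right 0))) \<and>
    (\<forall>t>0. {wball t x r | (x :: real ^ 'n) r. r > 0} = insert UNIV {ball x r | (x :: real ^ 'n) r. r > 0})"
proof (intro conjI allI impI exI[of _ "dist_profile (real CARD('n))"])
  fix t :: real and x y w :: "real ^ 'n"
  assume "t > 0"
  then show "wdist t (x + w) (y + w) = wdist t x y"
    by (simp add: wdist_eq_dist_profile)
qed (simp_all add: wdist_eq_dist_profile strict_mono_on_dist_profile continuous_on_dist_profile
      tendsto_dist_profile_ratio wballs_eq)

end
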